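(* Let $f=a_0+a_1x+\cdots +a_nx^n\in \mathbb Z[x]$ be a polynomial with $a_0a_n\neq 0$, and put $H_f=\max_{0\leq i\leq n-1}|a_i|/|a_n|$. Suppose there exist natural numbers $m$, $d$, $k$, $j\leq n$, and a prime $p$ with $p\nmid d$, such that $m\geq H_f+d+1$ and $|f(m)|/d=p^k$ is coprime to $f^{(j)}(m)/j!$, where $f^{(j)}$ denotes the $j$-th derivative of $f$. Then the polynomial $f$ is a product of at most $\min\{k,j\}$ irreducible factors in $\mathbb Z[x]$. In particular, if $k=1$ or $j=1$ for such an $m$, then $f$ is irreducible in $\mathbb Z[x]$.
   Formalization: As stated the claim fails for non-primitive f (f=2x+2, d=2, p=5, k=j=1, m=4). It is proved in ℤ[x] for f with content 1; for general f the bound and the irreducibility are proved for f divided by its content, i.e. ignoring constant factors. *)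

theory Defs
  imports "HOL-Computational_Algebra.Computational_Algebra"
begin

(* Only meaningful for degree f > 0: otherwise the maximum is over the empty set. *)
definition height_ratio :: "int poly \<Rightarrow> real" where
  "height_ratio f =
     Max ((\<lambda>i. real_of_int \<bar>coeff f i\<bar> / real_of_int \<bar>lead_coeff f\<bar>) ` {..<degree f})"

(* The integer division is exact; see fact_mult_taylor_coeff. *)
definition taylor_coeff :: "nat \<Rightarrow> int poly \<Rightarrow> int \<Rightarrow> int" where
  "taylor_coeff j f x = poly ((pderiv ^^ j) f) x div fact j"

lemma fact_dvd_poly_higher_pderiv:
  fixes f :: "int poly"
  shows "fact j dvd poly ((pderiv ^^ j) f) x"
  unfolding poly_altdef coeff_higher_pderiv
  by (intro dvd_sum dvd_mult2 fact_dvd_pochhammer)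

lemma fact_mult_taylor_coeff: "fact j * taylor_coeff j f x = poly ((pderiv ^^ j) f) x"
  by (simp add: taylor_coeff_def fact_dvd_poly_higher_pderiv)

(* "irreducible" is the ring-theoretic notion of the library, so over the integers
   non-unit constants count as factors: 2x + 2 = 2(x + 1) is reducible. *)
definition irreducible_product :: "nat \<Rightarrow> 'a::comm_semiring_1 \<Rightarrow> bool" where
  "irreducible_product N a \<longleftrightarrow>
     (\<exists>gs. length gs \<le> N \<and> (\<forall>g\<in>set gs. irreducible g) \<and> a = prod_list gs)"

end

theory Submission
  imports Defs
begin

text \<open>
  Cauchy's bound puts all complex roots of \<open>f\<close> in the open disc of radius \<open>H + 1\<close>, so they all lie
  at distance more than \<open>d\<close> from \<open>m\<close>, and every nonconstant divisor \<open>h\<close> of \<open>f\<close> has \<open>\<bar>h(m)\<bar> > d\<close>.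
  Since \<open>h(m)\<close> divides \<open>d p\<^sup>k\<close>, this forces \<open>p\<close> to divide \<open>h(m)\<close>. If the primitive part of \<open>f\<close> has
  \<open>r\<close> irreducible factors, then \<open>p\<^sup>r\<close> divides \<open>d p\<^sup>k\<close>, hence \<open>r \<le> k\<close>; moreover, modulo \<open>p\<close>, the shifted
  polynomial \<open>f(m + x)\<close> is divisible by \<open>x\<^sup>r\<close>, so its \<open>j\<close>-th coefficient, the Taylor coefficient at \<open>m\<close>, could not be
  prime to \<open>p\<close> if \<open>j < r\<close>.
\<close>

section \<open>Cauchy's root bound and the size of divisors at \<open>m\<close>\<close>

lemma map_poly_of_int_mult:
  "map_poly of_int (p * q) =
    (map_poly of_int p * map_poly of_int q :: 'a::{comm_ring_1,ring_char_0} poly)"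
  by (rule poly_eqI) (simp add: coeff_mult coeff_map_poly)

lemma poly_map_poly_of_int:
  "poly (map_poly of_int p) (of_int x) =
    (of_int (poly p x) :: 'a::{comm_ring_1,ring_char_0})"
  by (induction p) (simp_all add: map_poly_pCons)

text \<open>At a root the leading term balances the rest. With \<open>?r\<close> at least
  \<open>?H + 1\<close>, the geometric sum bounds the rest by \<open>?l * (?r ^ ?n - 1)\<close>,
  which is too small.\<close>

lemma cauchy_root_bound:
  fixes f :: "int poly" and z :: complex
  assumes "degree f > 0" and root: "poly (map_poly of_int f) z = 0"
  shows "norm z < height_ratio f + 1"
proof (rule ccontr)
  let ?n = "degree f" and ?r = "norm z" and ?H = "height_ratio f"
  let ?l = "real_of_int \<bar>lead_coeff f\<bar>"
  assume "\<not> ?thesis"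
  then have H: "?H \<le> ?r - 1" by simp
  have l: "?l > 0" using assms(1) by auto
  have coeff_le: "real_of_int \<bar>coeff f i\<bar> \<le> ?H * ?l" if "i < ?n" for i
  proof -
    have "real_of_int \<bar>coeff f i\<bar> / ?l \<le> ?H"
      unfolding height_ratio_def using that by (intro Max_ge) auto
    then show ?thesis using l by (simp add: pos_divide_le_eq)
  qed
  have "(\<Sum>i<?n. of_int (coeff f i) * z ^ i) + of_int (lead_coeff f) * z ^ ?n = 0"
    using root by (simp add: poly_altdef degree_map_poly coeff_map_poly flip: lessThan_Suc_atMost)
  then have "of_int (lead_coeff f) * z ^ ?n = - (\<Sum>i<?n. of_int (coeff f i) * z ^ i)"
    by (simp add: eq_neg_iff_add_eq_0 add.commute)
  then have "norm (of_int (lead_coeff f) * z ^ ?n) = norm (\<Sum>i<?n. of_int (coeff f i) * z ^ i)"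
    by simp
  then have "?l * ?r ^ ?n = norm (\<Sum>i<?n. of_int (coeff f i) * z ^ i)"
    by (simp add: norm_mult norm_power)
  also have "\<dots> \<le> (\<Sum>i<?n. real_of_int \<bar>coeff f i\<bar> * ?r ^ i)"
    by (rule order.trans[OF norm_sum]) (simp add: norm_mult norm_power)
  also have "\<dots> \<le> (\<Sum>i<?n. ?H * ?l * ?r ^ i)"
    by (intro sum_mono mult_right_mono coeff_le) auto
  also have "\<dots> = ?H * ?l * (\<Sum>i<?n. ?r ^ i)"
    by (simp add: sum_distrib_left)
  also have "\<dots> \<le> (?r - 1) * ?l * (\<Sum>i<?n. ?r ^ i)"
    using H l by (intro mult_right_mono sum_nonneg) auto
  also have "\<dots> = ?l * (?r ^ ?n - 1)"
    by (simp add: power_diff_1_eq)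
  finally show False using l by (simp add: algebra_simps)
qed

lemma prod_mset_gt:
  fixes d :: real
  assumes "A \<noteq> {#}" and "d \<ge> 1" and "\<And>x. x \<in># A \<Longrightarrow> g x > d"
  shows "(\<Prod>x\<in>#A. g x) > d"
  using assms(1,3)
proof (induction A)
  case (add a A)
  show ?case
  proof (cases "A = {#}")
    case False
    then have "(\<Prod>x\<in>#A. g x) > d" using add by auto
    moreover have "g a > d" using add.prems by simp
    ultimately have "g a * (\<Prod>x\<in>#A. g x) > d * 1"
      using \<open>d \<ge> 1\<close> by (intro mult_strict_mono) auto
    then show ?thesis by simp
  qed (use add in auto)
qed simp

text \<open>Over the complex numbers, \<open>h(m)\<close> is the leading coefficient, a nonzero
  integer, times the product of \<open>m - x\<close> over the roots \<open>x\<close> of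
  \<open>h\<close>. These are roots of \<open>f\<close>, so each factor exceeds \<open>d\<close> in
  norm.\<close>

lemma abs_poly_gt_of_dvd:
  fixes f h :: "int poly" and m d :: nat
  assumes "h dvd f" and "degree h > 0" and "f \<noteq> 0" and "d \<ge> 1"
    and m: "real m \<ge> height_ratio f + real d + 1"
  shows "\<bar>poly h (int m)\<bar> > int d"
proof -
  let ?h = "map_poly of_int h :: complex poly"
  have deg: "degree ?h = degree h" by (simp add: degree_map_poly)
  have h0: "?h \<noteq> 0" using assms(2) deg by auto
  obtain A where A: "size A = degree ?h" "?h = smult (lead_coeff ?h) (\<Prod>x\<in>#A. [:-x, 1:])"
    using alg_closed_imp_factorization[OF h0] by blast
  have A_ne: "A \<noteq> {#}" using A(1) deg assms(2) by auto
  have far: "norm (of_nat m - x) > real d" if "x \<in># A" for x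
  proof -
    have "poly (\<Prod>x\<in>#A. [:-x, 1:]) x = 0"
      using that by (auto simp: poly_prod_mset prod_mset_zero_iff image_iff)
    then have "poly ?h x = 0" by (subst A(2)) simp
    then have "poly (map_poly of_int f) x = 0"
      using \<open>h dvd f\<close> by (auto simp: dvd_def map_poly_of_int_mult)
    moreover have "degree f > 0"
      using dvd_imp_degree_le[OF \<open>h dvd f\<close> \<open>f \<noteq> 0\<close>] assms(2) by simp
    ultimately have "norm x < height_ratio f + 1" by (intro cauchy_root_bound)
    moreover have "norm (of_nat m :: complex) \<le> norm (of_nat m - x) + norm x"
      using norm_triangle_ineq[of "of_nat m - x" x] by simp
    ultimately show ?thesis using m by simp
  qed
  have "poly ?h (of_nat m) = lead_coeff ?h * (\<Prod>x\<in>#A. of_nat m - x)"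
    by (subst A(2)) (simp add: poly_prod_mset algebra_simps image_mset.compositionality o_def)
  then have "norm (poly ?h (of_nat m)) = norm (lead_coeff ?h) * norm (\<Prod>x\<in>#A. of_nat m - x)"
    by (simp only: norm_mult)
  also have "norm (\<Prod>x\<in>#A. of_nat m - x) = (\<Prod>x\<in>#A. norm (of_nat m - x))"
    by (induction A) (simp_all add: norm_mult)
  also have "norm (lead_coeff ?h) = real_of_int \<bar>lead_coeff h\<bar>"
    by (simp add: deg coeff_map_poly)
  also have "poly ?h (of_nat m) = of_int (poly h (int m))"
    using poly_map_poly_of_int[of h "int m", where 'a = complex] by simp
  finally have eq: "real_of_int \<bar>poly h (int m)\<bar> =
      real_of_int \<bar>lead_coeff h\<bar> * (\<Prod>x\<in>#A. norm (of_nat m - x))"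
    by simp
  have "(\<Prod>x\<in>#A. norm (of_nat m - x)) > real d"
    using A_ne \<open>d \<ge> 1\<close> far by (intro prod_mset_gt) auto
  moreover have "real_of_int \<bar>lead_coeff h\<bar> \<ge> 1"
  proof -
    have "lead_coeff h \<noteq> 0" using assms(2) by auto
    then have "\<bar>lead_coeff h\<bar> \<ge> 1" by linarith
    then show ?thesis by linarith
  qed
  ultimately have "real_of_int \<bar>lead_coeff h\<bar> * (\<Prod>x\<in>#A. norm (of_nat m - x)) \<ge>
      1 * (\<Prod>x\<in>#A. norm (of_nat m - x))"
    by (intro mult_right_mono) auto
  with eq \<open>(\<Prod>x\<in>#A. norm (of_nat m - x)) > real d\<close>
  have "real_of_int \<bar>poly h (int m)\<bar> > real d" by linarith
  then show ?thesis by linarith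
qed

section \<open>Taylor coefficients as coefficients of the shifted polynomial\<close>

lemma higher_pderiv_pcompose_shift:
  "(pderiv ^^ j) (pcompose f [:x, 1:]) = pcompose ((pderiv ^^ j) f) [:x, 1:]"
  by (induction j) (simp_all add: pderiv_pcompose pderiv_pCons)

lemma taylor_coeff_eq_coeff_pcompose:
  "taylor_coeff j f x = coeff (pcompose f [:x, 1:]) j"
proof -
  have "poly ((pderiv ^^ j) f) x = coeff ((pderiv ^^ j) (pcompose f [:x, 1:])) 0"
    by (simp add: higher_pderiv_pcompose_shift poly_pcompose flip: poly_0_coeff_0)
  also have "\<dots> = fact j * coeff (pcompose f [:x, 1:]) j"
    by (simp add: coeff_higher_pderiv pochhammer_fact)
  finally show ?thesis by (simp add: taylor_coeff_def)
qed

text \<open>Each shifted factor has constant term \<open>poly g x\<close>, hence is a multiple of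
  the variable modulo \<open>p\<close>; a product of r such factors has no terms of degree below r
  modulo \<open>p\<close>.\<close>

lemma dvd_coeff_pcompose_prod_list:
  fixes p x :: int
  assumes "\<And>g. g \<in> set gs \<Longrightarrow> p dvd poly g x" and "j < length gs"
  shows "p dvd coeff (pcompose (prod_list gs) [:x, 1:]) j"
  using assms
proof (induction gs arbitrary: j)
  case (Cons g gs)
  let ?G = "pcompose g [:x, 1:]" and ?Gs = "pcompose (prod_list gs) [:x, 1:]"
  \<comment> \<open>For \<open>i = 0\<close> the constant term of the head supplies
    \<open>p\<close>; for positive \<open>i\<close> the index \<open>j - i\<close> is below the
    length of the tail.\<close>
  have "p dvd coeff ?G i * coeff ?Gs (j - i)" if "i \<le> j" for i
  proof (cases "i = 0")
    case True
    have "coeff ?G 0 = poly g x" by (simp add: poly_pcompose flip: poly_0_coeff_0)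
    with True Cons.prems(1) show ?thesis by simp
  next
    case False
    then have "p dvd coeff ?Gs (j - i)" using Cons.prems that by (intro Cons.IH) auto
    then show ?thesis by simp
  qed
  then show ?case by (auto simp: pcompose_mult coeff_mult intro!: dvd_sum)
qed simp

lemma power_length_dvd_poly_prod_list:
  fixes p x :: "'a::comm_semiring_1"
  assumes "\<And>g. g \<in> set gs \<Longrightarrow> p dvd poly g x"
  shows "p ^ length gs dvd poly (prod_list gs) x"
  using assms by (induction gs) (auto intro: mult_dvd_mono)

section \<open>Factorization into irreducibles\<close>

lemma irreducible_list_factorization:
  fixes x :: "'a::factorial_semiring"
  assumes "x \<noteq> 0" and "\<not> is_unit x"
  obtains gs where "gs \<noteq> []" "\<And>g. g \<in> set gs \<Longrightarrow> irreducible g" "x = prod_list gs"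
proof -
  obtain A where A: "\<And>y. y \<in># A \<Longrightarrow> prime y" "normalize (prod_mset A) = normalize x"
    using prime_factorization_exists'[OF assms(1)] by blast
  obtain u where u: "is_unit u" "x = u * prod_mset A"
    using A(2) by (elim associatedE2)
  obtain as where as: "mset as = A" using ex_mset by blast
  \<comment> \<open>The primes multiply to \<open>x\<close> only up to the unit \<open>u\<close>. As
    \<open>x\<close> is not a unit, there is a first prime, which can absorb
    \<open>u\<close>.\<close>
  have "as \<noteq> []" using u assms(2) as by auto
  then obtain b bs where b: "as = b # bs" by (cases as) auto
  have irr: "irreducible y" if "y \<in> set as" for y
    using A(1) that as by (metis prime_imp_prime_elem prime_elem_imp_irreducible set_mset_mset)
  show thesis
  proof (rule that[of "(u * b) # bs"])
    show "irreducible g" if "g \<in> set ((u * b) # bs)" for g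
      using that irr u(1) b by (auto simp: irreducible_mult_unit_left)
    show "x = prod_list ((u * b) # bs)"
      using u(2) as b by (auto simp: mult.assoc simp flip: prod_mset_prod_list)
  qed simp
qed

text \<open>A constant divisor of \<open>g\<close> divides its content 1, so it is a unit.\<close>

lemma degree_pos_of_irreducible_dvd_primitive:
  fixes g h :: "'a::semiring_gcd poly"
  assumes "content g = 1" and "h dvd g" and "irreducible h"
  shows "degree h > 0"
proof (rule ccontr)
  assume "\<not> ?thesis"
  then obtain c where c: "h = [:c:]" by (auto elim: degree_eq_zeroE)
  then have "is_unit c" using assms(1,2) by (simp add: const_poly_dvd_iff_dvd_content)
  with assms(3) c show False by (simp add: irreducible_const_poly_iff irreducible_not_unit)
qed

section \<open>Counting the irreducible factors\<close>

theorem theorem2: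
  fixes f :: "int poly" and n m d k j p :: nat
  assumes "degree f = n" and "n \<ge> 1"
    and "coeff f 0 * coeff f n \<noteq> 0"
    and "j \<le> n"
    and "prime p" and "\<not> p dvd d"
    and "real m \<ge> height_ratio f + real d + 1"
    and "real_of_int \<bar>poly f (int m)\<bar> / real d = real (p ^ k)"
    and "coprime (int (p ^ k)) (taylor_coeff j f (int m))"
  shows
    \<comment> \<open>irreducibility up to constant factors, for every f\<close>
    "(\<exists>g. f = smult (content f) g \<and> irreducible_product (min k j) g \<and>
          (k = 1 \<or> j = 1 \<longrightarrow> irreducible g)) \<and>
    \<comment> \<open>irreducibility in the polynomial ring over the integers, for primitive f\<close>
     (content f = 1 \<longrightarrow> irreducible_product (min k j) f \<and>
          (k = 1 \<or> j = 1 \<longrightarrow> irreducible f))"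
proof -
  let ?f = "poly f (int m)"
  have f0: "f \<noteq> 0" and deg: "degree f > 0" using assms(1-3) by auto
  have d: "d \<ge> 1" using \<open>\<not> p dvd d\<close> by (cases d) auto
  have "real_of_int \<bar>?f\<bar> = real_of_int (int d * int p ^ k)"
    using assms(8) d by (simp add: field_simps)
  then have fm: "\<bar>?f\<bar> = int d * int p ^ k" by (simp only: of_int_eq_iff)
  have large: "\<bar>poly h (int m)\<bar> > int d" if "h dvd f" "degree h > 0" for h
    using that f0 d assms(7) by (rule abs_poly_gt_of_dvd)
  \<comment> \<open>For \<open>k = 0\<close> the value of \<open>f\<close> itself would have
    absolute value only \<open>d\<close>.\<close>
  have "k \<noteq> 0" using large[of f] deg fm by (cases k) auto
  have prime_p: "prime (int p)" using \<open>prime p\<close> by simp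
  have p_dvd: "int p dvd poly h (int m)" if "h dvd f" "degree h > 0" for h
  proof (rule ccontr)
    assume "\<not> ?thesis"
    then have "coprime (int p) (poly h (int m))" using prime_p by (rule prime_imp_coprime[rotated])
    then have "coprime (poly h (int m)) (int p ^ k)" by (metis coprime_commute coprime_power_right_iff)
    moreover have "poly h (int m) dvd ?f" using that(1) by (auto simp: dvd_def)
    then have "poly h (int m) dvd int d * int p ^ k" by (simp flip: fm)
    ultimately have "poly h (int m) dvd int d" by (simp add: coprime_dvd_mult_left_iff)
    then have "\<bar>poly h (int m)\<bar> \<le> int d" using d dvd_imp_le_int[of "int d"] by simp
    with large[OF that] show False by simp
  qed
  have not_dvd_taylor: "\<not> int p dvd taylor_coeff j f (int m)"
  proof
    assume "int p dvd taylor_coeff j f (int m)"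
    moreover have "int p dvd int (p ^ k)" using \<open>k \<noteq> 0\<close> by simp
    ultimately have "is_unit (int p)" using assms(9) by (meson coprime_def)
    then show False using prime_p by auto
  qed

  \<comment> \<open>The content may contribute constant irreducible factors, to which
    \<open>p_dvd\<close> does not apply; those of \<open>g\<close> are all nonconstant.\<close>
  define g where "g = primitive_part f"
  have fg: "f = smult (content f) g" by (simp add: g_def)
  then have "g dvd f" by (metis dvd_refl dvd_smult)
  have cont: "content g = 1" using f0 by (simp add: g_def)
  have "degree g > 0" using deg by (simp add: g_def)
  then have "g \<noteq> 0" "\<not> is_unit g" by (auto simp: is_unit_poly_iff)
  then obtain gs where gs: "gs \<noteq> []" "\<And>h. h \<in> set gs \<Longrightarrow> irreducible h" "g = prod_list gs"
    using irreducible_list_factorization by metis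
  have gs_dvd: "int p dvd poly h (int m)" if "h \<in> set gs" for h
  proof (rule p_dvd)
    have "h dvd g" using gs(3) split_list[OF that] by auto
    then show "h dvd f" using \<open>g dvd f\<close> by (rule dvd_trans)
    show "degree h > 0"
      using cont \<open>h dvd g\<close> gs(2)[OF that] by (rule degree_pos_of_irreducible_dvd_primitive)
  qed

  have "length gs \<le> k"
  proof -
    have "int p ^ length gs dvd poly g (int m)"
      unfolding gs(3) using gs_dvd by (rule power_length_dvd_poly_prod_list)
    also have "\<dots> dvd ?f" using \<open>g dvd f\<close> by (auto simp: dvd_def)
    finally have "int p ^ length gs dvd int d * int p ^ k" by (simp flip: fm)
    moreover have "coprime (int p ^ length gs) (int d)"
      using prime_imp_coprime[OF \<open>prime p\<close> \<open>\<not> p dvd d\<close>] by simp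
    ultimately have "int p ^ length gs dvd int p ^ k"
      by (simp add: coprime_dvd_mult_right_iff)
    then have "p ^ length gs dvd p ^ k" by (simp flip: of_nat_power)
    then show ?thesis using prime_gt_1_nat[OF \<open>prime p\<close>] by (rule power_dvd_imp_le)
  qed
  moreover have "length gs \<le> j"
  proof (rule ccontr)
    assume "\<not> ?thesis"
    then have "int p dvd coeff (pcompose g [:int m, 1:]) j"
      unfolding gs(3) using gs_dvd by (intro dvd_coeff_pcompose_prod_list) auto
    \<comment> \<open>The coefficient for \<open>f\<close> is the content times the one for
      \<open>g\<close>.\<close>
    then have "int p dvd taylor_coeff j f (int m)"
      by (subst fg) (simp add: taylor_coeff_eq_coeff_pcompose pcompose_smult)
    with not_dvd_taylor show False ..
  qed
  ultimately have len: "length gs \<le> min k j" by simp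
  have prod: "irreducible_product (min k j) g"
    unfolding irreducible_product_def using len gs(2,3) by auto
  have irr: "irreducible g" if "k = 1 \<or> j = 1"
  proof -
    \<comment> \<open>The minimum is at most 1, and \<open>gs\<close> is nonempty.\<close>
    have "length gs = 1" using that len gs(1) by (cases gs) auto
    then show ?thesis using gs(2,3) by (auto simp: length_Suc_conv)
  qed
  have "g = f" if "content f = 1" using fg that by simp
  with fg prod irr show ?thesis by auto
qed

end
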